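(* Let $\mathfrak{g}=A_{4,1}\oplus A_1$ and let $\langle\cdot,\cdot\rangle$ be an inner product on $\mathfrak{g}$. Let $\eta>0$ and let $\{v_1,\dots,v_5\}$ be a basis of $\mathfrak{g}$, orthonormal with respect to $\eta\langle\cdot,\cdot\rangle$, whose only nonzero brackets (up to antisymmetry) are either (first case) $[v_1,v_2]=\alpha v_3+\gamma v_5$, $[v_1,v_3]=\beta v_5$, or (second case) $[v_1,v_2]=\alpha v_3+\gamma v_4$, $[v_1,v_3]=\beta v_5$, where in both cases $\alpha,\beta>0$ and $\gamma\in\mathbb{R}$. Then, in either case, $\langle\cdot,\cdot\rangle$ is a nilsoliton if and only if $\gamma=0$ and $\alpha=\beta$.
   Context: $A_{4,1}\oplus A_1$ is the five-dimensional real nilpotent Lie algebra having a basis with the brackets displayed in the claim (both forms describe the same Lie algebra up to isomorphism). An inner product on $\mathfrak{g}$ is identified with the left-invariant Riemannian metric $g$ it induces on the simply connected Lie group $G$ with Lie algebra $\mathfrak{g}$. Let $ric_g$ be the Ricci curvature tensor of $(G,g)$ (Levi-Civita connection), viewed as a symmetric bilinear form on $\mathfrak{g}$; since $\mathfrak{g}$ is nilpotent, $ric_g(u,v)=-\frac12\mathrm{tr}(ad_u\circ ad_v^* )-\frac14\mathrm{tr}(J_u\circ J_v)$, where $ad_uv=[u,v]$, $ad_v^*$ is the $g$-transpose of $ad_v$, and $J_uv=ad_v^*u$. The Ricci operator $Ric_g$ is defined by $ric_g(u,v)=g(Ric_g(u),v)$. The metric $g$ is a nilsoliton if $Ric_g\in\mathbb{R}\,\mathrm{Id}_{\mathfrak{g}}\oplus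 Der(\mathfrak{g})$, i.e. $Ric_g=c\,\mathrm{Id}+D$ for some $c\in\mathbb{R}$ and some derivation $D$ of $\mathfrak{g}$. *)

theory Defs
  imports "HOL-Analysis.Analysis"
begin

definition lie_bracket :: "('g::real_vector \<Rightarrow> 'g \<Rightarrow> 'g) \<Rightarrow> bool" where
  "lie_bracket br \<longleftrightarrow>
     bilinear br \<and> (\<forall>x. br x x = 0) \<and>
     (\<forall>x y z. br x (br y z) + br y (br z x) + br z (br x y) = 0)"

definition derivation :: "('g::real_vector \<Rightarrow> 'g \<Rightarrow> 'g) \<Rightarrow> ('g \<Rightarrow> 'g) \<Rightarrow> bool" where
  "derivation br D \<longleftrightarrow> linear D \<and> (\<forall>x y. D (br x y) = br (D x) y + br x (D y))"

text \<open>Bases of a five-dimensional space are families \<open>v 1, \<dots>, v 5\<close>; the values of \<open>v\<close> at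
  other indices are irrelevant.\<close>

definition basis5 :: "(nat \<Rightarrow> 'g::real_vector) \<Rightarrow> bool" where
  "basis5 v \<longleftrightarrow> inj_on v {1..5} \<and> independent (v ` {1..5}) \<and> span (v ` {1..5}) = UNIV"

text \<open>Up to antisymmetry, the only possibly nonzero brackets of the \<open>v i\<close> are
  \<open>[v 1, v 2] = p\<close> and \<open>[v 1, v 3] = q\<close>.\<close>

definition only_brackets :: "('g::real_vector \<Rightarrow> 'g \<Rightarrow> 'g) \<Rightarrow> (nat \<Rightarrow> 'g) \<Rightarrow> 'g \<Rightarrow> 'g \<Rightarrow> bool" where
  "only_brackets br v p q \<longleftrightarrow>
     (\<forall>i\<in>{1..5}. \<forall>j\<in>{1..5}. i < j \<longrightarrow>
        br (v i) (v j) = (if i = 1 \<and> j = 2 then p else if i = 1 \<and> j = 3 then q else 0))"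

text \<open>The Lie algebra \<open>A\<^sub>4\<^sub>,\<^sub>1 \<oplus> A\<^sub>1\<close>, up to isomorphism: \<open>e 1, e 2, e 3, e 5\<close> span the filiform
  algebra \<open>A\<^sub>4\<^sub>,\<^sub>1\<close> and \<open>e 4\<close> spans the abelian summand \<open>A\<^sub>1\<close>.\<close>

definition is_A41_plus_A1 :: "('g::real_vector \<Rightarrow> 'g \<Rightarrow> 'g) \<Rightarrow> bool" where
  "is_A41_plus_A1 br \<longleftrightarrow> lie_bracket br \<and> (\<exists>e. basis5 e \<and> only_brackets br e (e 3) (e 5))"

definition inner_product :: "('g::real_vector \<Rightarrow> 'g \<Rightarrow> real) \<Rightarrow> bool" where
  "inner_product g \<longleftrightarrow>
     bilinear g \<and> (\<forall>x y. g x y = g y x) \<and> (\<forall>x. x \<noteq> 0 \<longrightarrow> 0 < g x x)"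

definition orthonormal5 :: "('g::real_vector \<Rightarrow> 'g \<Rightarrow> real) \<Rightarrow> (nat \<Rightarrow> 'g) \<Rightarrow> bool" where
  "orthonormal5 g v \<longleftrightarrow> (\<forall>i\<in>{1..5}. \<forall>j\<in>{1..5}. g (v i) (v j) = (if i = j then 1 else 0))"

text \<open>Trace of an endomorphism of a finite-dimensional space: the sum of the diagonal matrix
  entries with respect to some basis (on which the value does not depend).\<close>

definition trace_endo :: "('g::real_vector \<Rightarrow> 'g) \<Rightarrow> real" where
  "trace_endo f =
     (let B = (SOME B. independent B \<and> span B = UNIV) in \<Sum>b\<in>B. representation B (f b) b)"

text \<open>The metric induced by \<open>g\<close> on the simply connected Lie group is described on left-invariant
  vector fields. Their inner products are constant, so the Koszul formula
  \<open>2 g(\<nabla>\<^bsub>x\<^esub> y, z) = g([x,y], z) - g([y,z], x) + g([z,x], y)\<close> determines the left-invariant field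
  \<open>\<nabla>\<^bsub>x\<^esub> y\<close>. The description is unique if \<open>g\<close> is an inner product on a finite-dimensional space.\<close>

definition levi_civita ::
  "('g::real_vector \<Rightarrow> 'g \<Rightarrow> 'g) \<Rightarrow> ('g \<Rightarrow> 'g \<Rightarrow> real) \<Rightarrow> 'g \<Rightarrow> 'g \<Rightarrow> 'g" where
  "levi_civita br g x y =
     (THE w. \<forall>z. 2 * g w z = g (br x y) z - g (br y z) x + g (br z x) y)"

definition riemann_curvature ::
  "('g::real_vector \<Rightarrow> 'g \<Rightarrow> 'g) \<Rightarrow> ('g \<Rightarrow> 'g \<Rightarrow> real) \<Rightarrow> 'g \<Rightarrow> 'g \<Rightarrow> 'g \<Rightarrow> 'g" where
  "riemann_curvature br g x y z =
     levi_civita br g x (levi_civita br g y z) - levi_civita br g y (levi_civita br g x z)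
       - levi_civita br g (br x y) z"

text \<open>With this sign convention round spheres have positive Ricci curvature. For nilpotent Lie
  algebras the tensor below is
  \<open>ric(u,v) = - 1/2 tr(ad\<^sub>u \<circ> ad\<^sub>v\<^sup>*) - 1/4 tr(J\<^sub>u \<circ> J\<^sub>v)\<close>, where \<open>J\<^sub>u w = ad\<^sub>w\<^sup>* u\<close>.\<close>

definition ricci_tensor ::
  "('g::real_vector \<Rightarrow> 'g \<Rightarrow> 'g) \<Rightarrow> ('g \<Rightarrow> 'g \<Rightarrow> real) \<Rightarrow> 'g \<Rightarrow> 'g \<Rightarrow> real" where
  "ricci_tensor br g u v = trace_endo (\<lambda>x. riemann_curvature br g x u v)"

definition ricci_operator ::
  "('g::real_vector \<Rightarrow> 'g \<Rightarrow> 'g) \<Rightarrow> ('g \<Rightarrow> 'g \<Rightarrow> real) \<Rightarrow> 'g \<Rightarrow> 'g" where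
  "ricci_operator br g u = (THE w. \<forall>v. ricci_tensor br g u v = g w v)"

definition nilsoliton ::
  "('g::real_vector \<Rightarrow> 'g \<Rightarrow> 'g) \<Rightarrow> ('g \<Rightarrow> 'g \<Rightarrow> real) \<Rightarrow> bool" where
  "nilsoliton br g \<longleftrightarrow>
     (\<exists>c D. derivation br D \<and> (\<forall>u. ricci_operator br g u = c *\<^sub>R u + D u))"

end

theory Submission
  imports Defs
begin

text \<open>In coordinates with respect to the orthonormal basis, the Koszul formula makes the
  Levi-Civita connection and hence the Ricci operator explicit. Both families of brackets are
  instances of \<open>[v 1, v 2] = a v 3 + d v 4 + c v 5\<close>, \<open>[v 1, v 3] = b v 5\<close>, where the Ricci
  operator has the off-diagonal entries \<open>- b c / 2\<close>, \<open>a d / 2\<close>, \<open>a c / 2\<close>, \<open>c d / 2\<close> at the positions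
  \<open>(2,3)\<close>, \<open>(3,4)\<close>, \<open>(3,5)\<close>, \<open>(4,5)\<close>. If it is a derivation up to a multiple of the identity,
  then the relation \<open>[v 1, v 4] = 0\<close> forces \<open>d = 0\<close>, the \<open>v 3\<close>-component of \<open>[v 1, v 3] = b v 5\<close>
  forces \<open>c = 0\<close>, and comparing the eigenvalues in the two remaining relations forces
  \<open>a\<^sup>2 = b\<^sup>2\<close>.\<close>

section \<open>Rescaling of the metric, and nondegeneracy\<close>

declare One_nat_def [simp del]

lemma atLeastAtMost_1_5: "{1..5::nat} = {1, 2, 3, 4, 5}"
  by auto

text \<open>Every term of the Koszul formula is homogeneous of degree one in the metric, so the
  conditions that describe the two connections are equivalent.\<close>

lemma levi_civita_scale:
  assumes "k \<noteq> 0"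
  shows "levi_civita br (\<lambda>x y. k * g x y) = levi_civita br g"
proof -
  have "2 * (k * g w z) = k * g (br x y) z - k * g (br y z) x + k * g (br z x) y \<longleftrightarrow>
        2 * g w z = g (br x y) z - g (br y z) x + g (br z x) y" for w x y z
  proof -
    have "2 * (k * g w z) = k * g (br x y) z - k * g (br y z) x + k * g (br z x) y \<longleftrightarrow>
          k * (2 * g w z) = k * (g (br x y) z - g (br y z) x + g (br z x) y)"
      by (simp add: algebra_simps)
    then show ?thesis
      using assms by simp
  qed
  then show ?thesis
    by (simp add: levi_civita_def fun_eq_iff)
qed

text \<open>The metric enters the tensor only through the connection; the trace does not involve
  it.\<close>

lemma ricci_tensor_scale:
  assumes "k \<noteq> 0"
  shows "ricci_tensor br (\<lambda>x y. k * g x y) = ricci_tensor br g"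
  by (simp add: ricci_tensor_def riemann_curvature_def levi_civita_scale[OF assms] fun_eq_iff)

text \<open>Nondegeneracy; it supplies uniqueness in the definite descriptions of the connection and
  of the Ricci operator.\<close>

lemma inner_product_eqI:
  assumes "inner_product g" "\<And>z. g x z = g y z"
  shows "x = y"
proof (rule ccontr)
  assume "x \<noteq> y"
  then have "0 < g (x - y) (x - y)"
    using assms(1) by (simp add: inner_product_def)
  moreover have "g (x - y) (x - y) = g x (x - y) - g y (x - y)"
    using assms(1) by (simp add: inner_product_def bilinear_lsub)
  ultimately show False
    using assms(2) by simp
qed

lemma inner_product_scale:
  assumes "inner_product g" "0 < k"
  shows "inner_product (\<lambda>x y. k * g x y)"
  using assms unfolding inner_product_def bilinear_def linear_iff
  by (auto simp: algebra_simps)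

lemma ricci_operator_eq:
  assumes "inner_product g" "\<And>z. ricci_tensor br g u z = g w z"
  shows "ricci_operator br g u = w"
  unfolding ricci_operator_def
proof (rule the_equality)
  show "w' = w" if "\<forall>z. ricci_tensor br g u z = g w' z" for w'
    using that assms by (intro inner_product_eqI[OF assms(1)]) metis
qed (use assms(2) in simp)

section \<open>Coordinates, traces and the connection in an orthonormal basis\<close>

locale orthonormal_basis5 =
  fixes g :: "'g::real_vector \<Rightarrow> 'g \<Rightarrow> real" and v :: "nat \<Rightarrow> 'g"
  assumes ip: "inner_product g" and basis: "basis5 v" and orthonormal: "orthonormal5 g v"
begin

lemma bilinear_g: "bilinear g"
  using ip by (simp add: inner_product_def)

lemma g_commute: "g x y = g y x"
  using ip by (simp add: inner_product_def)

lemmas g_simps = bilinear_ladd[OF bilinear_g] bilinear_radd[OF bilinear_g]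
  bilinear_lsub[OF bilinear_g] bilinear_rsub[OF bilinear_g]
  bilinear_lmul[OF bilinear_g] bilinear_rmul[OF bilinear_g]
  bilinear_lzero[OF bilinear_g] bilinear_rzero[OF bilinear_g]
  bilinear_lneg[OF bilinear_g] bilinear_rneg[OF bilinear_g]

lemma linear_g_left: "linear (\<lambda>x. g x y)"
  using bilinear_g by (simp add: bilinear_def)

lemma g_basis: "i \<in> {1..5} \<Longrightarrow> j \<in> {1..5} \<Longrightarrow> g (v i) (v j) = (if i = j then 1 else 0)"
  using orthonormal by (auto simp: orthonormal5_def)

lemma coords_eqI:
  assumes "\<And>i. i \<in> {1..5} \<Longrightarrow> g x (v i) = g y (v i)"
  shows "x = y"
proof (rule inner_product_eqI[OF ip])
  fix z
  have "z \<in> span (v ` {1..5})"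
    using basis by (simp add: basis5_def)
  then show "g x z = g y z"
    by (induction rule: span_induct) (auto simp: assms g_simps subspace_def)
qed

lemma g_sum_basis:
  assumes "i \<in> {1..5}"
  shows "g (\<Sum>j=1..5. f j *\<^sub>R v j) (v i) = f i"
proof -
  have "g (\<Sum>j=1..5. f j *\<^sub>R v j) (v i) = (\<Sum>j=1..5. f j * g (v j) (v i))"
    by (simp add: linear_sum[OF linear_g_left] g_simps)
  also have "\<dots> = (\<Sum>j=1..5. if j = i then f j else 0)"
    using assms by (intro sum.cong) (auto simp: g_basis)
  finally show ?thesis
    using assms by simp
qed

lemma expansion: "x = (\<Sum>i=1..5. g x (v i) *\<^sub>R v i)"
  by (rule coords_eqI) (simp add: g_sum_basis)

lemma g_coords: "g x y = (\<Sum>i=1..5. g x (v i) * g y (v i))"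
proof -
  have "g x y = g (\<Sum>i=1..5. g x (v i) *\<^sub>R v i) y"
    using expansion[of x] by simp
  then show ?thesis
    by (simp add: linear_sum[OF linear_g_left] g_simps) (simp add: g_commute[of y])
qed

text \<open>Basis independence of the trace: expand each \<open>f b\<close> in the
  \<open>v i\<close> and swap the two sums; the \<open>B\<close>-coefficients of \<open>v i\<close>
  then reassemble \<open>v i\<close> inside \<open>f\<close>.\<close>

lemma trace_endo_eq:
  assumes "linear f"
  shows "trace_endo f = (\<Sum>i=1..5. g (f (v i)) (v i))"
proof -
  define B where "B = (SOME B::'g set. independent B \<and> span B = UNIV)"
  have "independent B \<and> span B = UNIV"
    unfolding B_def by (rule someI_ex) (use basis in \<open>auto simp: basis5_def\<close>)
  then have ind: "independent B" and span: "span B = UNIV"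
    by auto
  \<comment> \<open>An independent set in the span of five vectors is finite; over an infinite
    \<open>B\<close> the sum would default to 0.\<close>
  have "finite B"
    using independent_span_bound[of "v ` {1..5}" B] ind basis by (simp add: basis5_def)
  have rep: "representation B (f b) b = (\<Sum>i=1..5. g (f b) (v i) * representation B (v i) b)" for b
  proof -
    have "representation B (f b) = representation B (\<Sum>i=1..5. g (f b) (v i) *\<^sub>R v i)"
      using expansion[of "f b"] by simp
    then show ?thesis
      by (simp add: representation_sum[OF ind] representation_scale[OF ind] span)
  qed
  have "trace_endo f = (\<Sum>b\<in>B. \<Sum>i=1..5. g (f b) (v i) * representation B (v i) b)"
    unfolding trace_endo_def by (simp add: B_def[symmetric] Let_def rep)
  also have "\<dots> = (\<Sum>i=1..5. \<Sum>b\<in>B. representation B (v i) b * g (f b) (v i))"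
    by (subst sum.swap) (simp add: mult.commute)
  also have "\<dots> = (\<Sum>i=1..5. g (f (\<Sum>b\<in>B. representation B (v i) b *\<^sub>R b)) (v i))"
    by (simp add: linear_sum[OF assms] linear_sum[OF linear_g_left] linear_scale[OF assms] g_simps)
  also have "\<dots> = (\<Sum>i=1..5. g (f (v i)) (v i))"
    using ind span \<open>finite B\<close> by (simp add: sum_representation_eq)
  finally show ?thesis .
qed

lemma levi_civita_coords:
  assumes "bilinear br" and k: "k \<in> {1..5}"
  shows "g (levi_civita br g x y) (v k) =
    (g (br x y) (v k) - g (br y (v k)) x + g (br (v k) x) y) / 2"
proof -
  \<comment> \<open>\<open>F\<close> is half the right-hand side of the Koszul formula as a
    functional of \<open>z\<close>, and \<open>w\<close> is its Riesz representative; this gives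
    existence in the definite description.\<close>
  define F where "F z = (g (br x y) z - g (br y z) x + g (br z x) y) / 2" for z
  define w where "w = (\<Sum>i=1..5. F (v i) *\<^sub>R v i)"
  have "linear F"
    unfolding F_def linear_iff
    by (simp add: g_simps bilinear_ladd[OF assms(1)] bilinear_radd[OF assms(1)]
        bilinear_lmul[OF assms(1)] bilinear_rmul[OF assms(1)] field_simps)
  have w: "g w z = F z" for z
  proof -
    have "g w z = (\<Sum>i=1..5. g z (v i) * F (v i))"
      by (subst g_coords) (simp add: w_def g_sum_basis mult.commute)
    also have "\<dots> = F (\<Sum>i=1..5. g z (v i) *\<^sub>R v i)"
      by (simp add: linear_sum[OF \<open>linear F\<close>] linear_scale[OF \<open>linear F\<close>])
    finally show ?thesis
      by (simp add: expansion[of z, symmetric])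
  qed
  have "levi_civita br g x y = w"
    unfolding levi_civita_def
  proof (rule the_equality)
    show "\<forall>z. 2 * g w z = g (br x y) z - g (br y z) x + g (br z x) y"
      by (simp add: w F_def)
    show "w' = w" if "\<forall>z. 2 * g w' z = g (br x y) z - g (br y z) x + g (br z x) y" for w'
    proof (rule inner_product_eqI[OF ip])
      show "g w' z = g w z" for z
        using that[rule_format, of z] by (simp add: w F_def)
    qed
  qed
  then show ?thesis
    by (simp add: w F_def)
qed

lemma bilinear_levi_civita:
  assumes "bilinear br"
  shows "bilinear (levi_civita br g)"
  unfolding bilinear_def linear_iff
  by (intro conjI allI coords_eqI)
     (simp_all add: levi_civita_coords[OF assms] g_simps bilinear_ladd[OF assms]
        bilinear_radd[OF assms] bilinear_lmul[OF assms] bilinear_rmul[OF assms] field_simps)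

end

section \<open>Connection and Ricci operator of the four-parameter family of brackets\<close>

locale nilpotent_frame5 = orthonormal_basis5 +
  fixes br :: "'a::real_vector \<Rightarrow> 'a \<Rightarrow> 'a" and a b c d :: real
  assumes bilinear_br: "bilinear br" and br_self: "br x x = 0"
    and brackets: "only_brackets br v (a *\<^sub>R v 3 + d *\<^sub>R v 4 + c *\<^sub>R v 5) (b *\<^sub>R v 5)"
begin

lemmas br_simps = bilinear_ladd[OF bilinear_br] bilinear_radd[OF bilinear_br]
  bilinear_lmul[OF bilinear_br] bilinear_rmul[OF bilinear_br]

lemma br_skew: "br y x = - br x y"
  using br_self[of "x + y"] br_self[of x] br_self[of y]
  by (simp add: br_simps add_eq_0_iff)

lemma basis_coords:
  "g (v 1) (v 1) = 1" "g (v 1) (v 2) = 0" "g (v 1) (v 3) = 0" "g (v 1) (v 4) = 0" "g (v 1) (v 5) = 0"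
  "g (v 2) (v 1) = 0" "g (v 2) (v 2) = 1" "g (v 2) (v 3) = 0" "g (v 2) (v 4) = 0" "g (v 2) (v 5) = 0"
  "g (v 3) (v 1) = 0" "g (v 3) (v 2) = 0" "g (v 3) (v 3) = 1" "g (v 3) (v 4) = 0" "g (v 3) (v 5) = 0"
  "g (v 4) (v 1) = 0" "g (v 4) (v 2) = 0" "g (v 4) (v 3) = 0" "g (v 4) (v 4) = 1" "g (v 4) (v 5) = 0"
  "g (v 5) (v 1) = 0" "g (v 5) (v 2) = 0" "g (v 5) (v 3) = 0" "g (v 5) (v 4) = 0" "g (v 5) (v 5) = 1"
  by (simp_all add: g_basis)

lemma expansion5:
  "x = g x (v 1) *\<^sub>R v 1 + g x (v 2) *\<^sub>R v 2 + g x (v 3) *\<^sub>R v 3 + g x (v 4) *\<^sub>R v 4 + g x (v 5) *\<^sub>R v 5"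
  using expansion[of x] by (simp add: atLeastAtMost_1_5 add.assoc)

lemma br_basis:
  "br (v 1) (v 2) = a *\<^sub>R v 3 + d *\<^sub>R v 4 + c *\<^sub>R v 5" "br (v 1) (v 3) = b *\<^sub>R v 5"
  "br (v 1) (v 4) = 0" "br (v 1) (v 5) = 0" "br (v 2) (v 3) = 0" "br (v 2) (v 4) = 0"
  "br (v 2) (v 5) = 0" "br (v 3) (v 4) = 0" "br (v 3) (v 5) = 0" "br (v 4) (v 5) = 0"
  using brackets by (simp_all add: only_brackets_def)

lemma br_eq:
  "br x y = (g x (v 1) * g y (v 2) - g x (v 2) * g y (v 1)) *\<^sub>R (a *\<^sub>R v 3 + d *\<^sub>R v 4 + c *\<^sub>R v 5) +
     (g x (v 1) * g y (v 3) - g x (v 3) * g y (v 1)) *\<^sub>R (b *\<^sub>R v 5)"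
proof -
  \<comment> \<open>The brackets of basis vectors in the reversed order, obtained by negating the
    listed ones.\<close>
  note rev = br_basis[THEN arg_cong[where f = uminus], folded br_skew]
  show ?thesis
    by (subst expansion5[of x], subst expansion5[of y])
       (simp add: br_simps br_self br_basis rev algebra_simps)
qed

lemma br_coords:
  "g (br x y) (v 1) = 0" "g (br x y) (v 2) = 0"
  "g (br x y) (v 3) = a * (g x (v 1) * g y (v 2) - g x (v 2) * g y (v 1))"
  "g (br x y) (v 4) = d * (g x (v 1) * g y (v 2) - g x (v 2) * g y (v 1))"
  "g (br x y) (v 5) = c * (g x (v 1) * g y (v 2) - g x (v 2) * g y (v 1)) +
     b * (g x (v 1) * g y (v 3) - g x (v 3) * g y (v 1))"
  by (simp_all add: br_eq[of x y] g_simps basis_coords)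

lemma br_pairing:
  "g (br x y) z = (g x (v 1) * g y (v 2) - g x (v 2) * g y (v 1)) *
       (a * g z (v 3) + d * g z (v 4) + c * g z (v 5)) +
     (g x (v 1) * g y (v 3) - g x (v 3) * g y (v 1)) * b * g z (v 5)"
  by (subst br_eq) (simp add: g_simps g_commute[of _ z] algebra_simps)

text \<open>The terms antisymmetric in \<open>x\<close> and \<open>y\<close> are half the bracket,
  as for any torsion-free connection; the symmetric ones come from the transposes of
  \<open>ad\<close>.\<close>

lemma lc_coords:
  "g (levi_civita br g x y) (v 1) =
     (g x (v 2) * (a * g y (v 3) + d * g y (v 4) + c * g y (v 5)) +
      g y (v 2) * (a * g x (v 3) + d * g x (v 4) + c * g x (v 5)) +
      b * (g x (v 3) * g y (v 5) + g y (v 3) * g x (v 5))) / 2"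
  "g (levi_civita br g x y) (v 2) =
     - (g x (v 1) * (a * g y (v 3) + d * g y (v 4) + c * g y (v 5)) +
        g y (v 1) * (a * g x (v 3) + d * g x (v 4) + c * g x (v 5))) / 2"
  "g (levi_civita br g x y) (v 3) =
     (a * (g x (v 1) * g y (v 2) - g x (v 2) * g y (v 1)) -
      b * (g x (v 1) * g y (v 5) + g y (v 1) * g x (v 5))) / 2"
  "g (levi_civita br g x y) (v 4) = d * (g x (v 1) * g y (v 2) - g x (v 2) * g y (v 1)) / 2"
  "g (levi_civita br g x y) (v 5) =
     (c * (g x (v 1) * g y (v 2) - g x (v 2) * g y (v 1)) +
      b * (g x (v 1) * g y (v 3) - g x (v 3) * g y (v 1))) / 2"
  by (simp_all add: levi_civita_coords[OF bilinear_br] br_coords br_pairing basis_coords algebra_simps)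

text \<open>On the diagonal, the square of each structure constant contributes -1/2 at both inputs
  of its bracket and +1/2 at its output. Off the diagonal, \<open>b\<close> and \<open>c\<close>
  share the output \<open>v 5\<close> and couple the inputs \<open>v 2\<close>, \<open>v 3\<close>
  negatively, while \<open>a\<close>, \<open>c\<close>, \<open>d\<close> share their inputs and
  couple their outputs positively.\<close>

definition Ric :: "'a \<Rightarrow> 'a" where
  "Ric u = (- (a\<^sup>2 + b\<^sup>2 + c\<^sup>2 + d\<^sup>2) / 2 * g u (v 1)) *\<^sub>R v 1 +
    (- (a\<^sup>2 + c\<^sup>2 + d\<^sup>2) / 2 * g u (v 2) - b * c / 2 * g u (v 3)) *\<^sub>R v 2 +
    (- b * c / 2 * g u (v 2) + (a\<^sup>2 - b\<^sup>2) / 2 * g u (v 3) + a * d / 2 * g u (v 4) + a * c / 2 * g u (v 5)) *\<^sub>R v 3 +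
    (a * d / 2 * g u (v 3) + d\<^sup>2 / 2 * g u (v 4) + c * d / 2 * g u (v 5)) *\<^sub>R v 4 +
    (a * c / 2 * g u (v 3) + c * d / 2 * g u (v 4) + (b\<^sup>2 + c\<^sup>2) / 2 * g u (v 5)) *\<^sub>R v 5"

lemma Ric_coords:
  "g (Ric u) (v 1) = - (a\<^sup>2 + b\<^sup>2 + c\<^sup>2 + d\<^sup>2) / 2 * g u (v 1)"
  "g (Ric u) (v 2) = - (a\<^sup>2 + c\<^sup>2 + d\<^sup>2) / 2 * g u (v 2) - b * c / 2 * g u (v 3)"
  "g (Ric u) (v 3) = - b * c / 2 * g u (v 2) + (a\<^sup>2 - b\<^sup>2) / 2 * g u (v 3) +
     a * d / 2 * g u (v 4) + a * c / 2 * g u (v 5)"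
  "g (Ric u) (v 4) = a * d / 2 * g u (v 3) + d\<^sup>2 / 2 * g u (v 4) + c * d / 2 * g u (v 5)"
  "g (Ric u) (v 5) = a * c / 2 * g u (v 3) + c * d / 2 * g u (v 4) + (b\<^sup>2 + c\<^sup>2) / 2 * g u (v 5)"
  by (simp_all add: Ric_def g_simps basis_coords)

text \<open>Linearity in the slot over which the Ricci trace is taken, as
  \<open>trace_endo_eq\<close> requires.\<close>

lemma linear_riemann_curvature: "linear (\<lambda>x. riemann_curvature br g x y z)"
proof -
  note lc = bilinear_levi_civita[OF bilinear_br]
  show ?thesis
    unfolding riemann_curvature_def linear_iff
    by (simp add: br_simps bilinear_ladd[OF lc] bilinear_radd[OF lc] bilinear_lmul[OF lc]
        bilinear_rmul[OF lc] algebra_simps)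
qed

lemma ricci_tensor_eq: "ricci_tensor br g u w = g (Ric u) w"
proof -
  have "ricci_tensor br g u w = (\<Sum>i=1..5. g (riemann_curvature br g (v i) u w) (v i))"
    by (simp add: ricci_tensor_def trace_endo_eq[OF linear_riemann_curvature])
  also have "\<dots> = g (riemann_curvature br g (v 1) u w) (v 1) + g (riemann_curvature br g (v 2) u w) (v 2) +
      g (riemann_curvature br g (v 3) u w) (v 3) + g (riemann_curvature br g (v 4) u w) (v 4) +
      g (riemann_curvature br g (v 5) u w) (v 5)"
    by (simp add: atLeastAtMost_1_5)
  \<comment> \<open>In coordinates this is a polynomial identity in \<open>a\<close>,
    \<open>b\<close>, \<open>c\<close>, \<open>d\<close> and the components of \<open>u\<close> and
    \<open>w\<close>.\<close>
  also have "\<dots> = g (Ric u) (v 1) * g w (v 1) + g (Ric u) (v 2) * g w (v 2) +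
      g (Ric u) (v 3) * g w (v 3) + g (Ric u) (v 4) * g w (v 4) + g (Ric u) (v 5) * g w (v 5)"
    by (simp add: riemann_curvature_def g_simps lc_coords br_coords basis_coords Ric_coords)
       (simp add: field_simps power2_eq_square)
  also have "\<dots> = g (Ric u) w"
    by (subst g_coords[of "Ric u" w]) (simp add: atLeastAtMost_1_5)
  finally show ?thesis .
qed

section \<open>The nilsoliton condition and its invariance under rescaling\<close>

lemma coords5_eqI:
  assumes "g x (v 1) = g y (v 1)" "g x (v 2) = g y (v 2)" "g x (v 3) = g y (v 3)"
    "g x (v 4) = g y (v 4)" "g x (v 5) = g y (v 5)"
  shows "x = y"
  using assms by (intro coords_eqI) (auto simp: atLeastAtMost_1_5)

lemma nilsoliton_iff:
  assumes "a > 0" "b > 0"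
  shows "nilsoliton br g \<longleftrightarrow> c = 0 \<and> d = 0 \<and> a = b"
proof -
  have ricci_operator: "ricci_operator br g u = Ric u" for u
    by (rule ricci_operator_eq[OF ip ricci_tensor_eq])
  show ?thesis
  proof
    assume "nilsoliton br g"
    then obtain k D where der: "derivation br D" and Ric: "\<And>u. Ric u = k *\<^sub>R u + D u"
      by (auto simp: nilsoliton_def ricci_operator)
    have D: "D u = Ric u - k *\<^sub>R u" for u
      by (simp add: Ric)
    have leibniz: "g (D (br x y)) z = g (br (D x) y) z + g (br x (D y)) z" for x y z
      using der by (simp add: derivation_def g_simps)
    note coords = D br_coords g_simps Ric_coords basis_coords
    \<comment> \<open>\<open>D (v 4)\<close> has \<open>v 3\<close>-component
      \<open>a * d / 2\<close>, so its bracket with \<open>v 1\<close> has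
      \<open>v 5\<close>-component \<open>a * b * d / 2\<close>, which must vanish.\<close>
    have "d = 0"
      using leibniz[of "v 1" "v 4" "v 5"] assms by (simp add: coords)
    \<comment> \<open>The two sides of the Leibniz rule are \<open>a * b * c / 2\<close> and
      \<open>- a * b * c / 2\<close>.\<close>
    moreover have "c = 0"
      using leibniz[of "v 1" "v 3" "v 3"] assms by (simp add: coords field_simps)
    \<comment> \<open>Once \<open>c = d = 0\<close>, the operator \<open>D\<close> is diagonal, and
      the eigenvalues at the two inputs of a bracket must add up to the one at its output.\<close>
    moreover note leibniz[of "v 1" "v 3" "v 5", unfolded coords] leibniz[of "v 1" "v 2" "v 3", unfolded coords]
    ultimately have "b * (3 * b\<^sup>2 + 2 * k) = 0" "a * (3 * a\<^sup>2 + 2 * k) = 0"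
      by (simp_all add: field_simps power2_eq_square)
    then have "3 * b\<^sup>2 + 2 * k = 0" "3 * a\<^sup>2 + 2 * k = 0"
      using assms by auto
    then have "a\<^sup>2 = b\<^sup>2"
      by linarith
    then have "a = b"
      using assms by (simp add: power2_eq_iff_nonneg)
    with \<open>c = 0\<close> \<open>d = 0\<close> show "c = 0 \<and> d = 0 \<and> a = b"
      by simp
  next
    assume *: "c = 0 \<and> d = 0 \<and> a = b"
    \<comment> \<open>The shift is forced by \<open>3 * a\<^sup>2 + 2 * k = 0\<close>. On the basis
      \<open>D\<close> is \<open>a\<^sup>2\<close> times diag(1/2, 1, 3/2, 3/2, 2), and 1/2 + 1 =
      3/2, 1/2 + 3/2 = 2 match the two brackets.\<close>
    define D where "D u = Ric u + (3 / 2 * a\<^sup>2) *\<^sub>R u" for u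
    note coords = D_def br_coords g_simps Ric_coords
    have "linear D"
      unfolding linear_iff by (intro conjI allI coords5_eqI) (simp_all add: coords field_simps)
    moreover have "D (br x y) = br (D x) y + br x (D y)" for x y
      by (intro coords5_eqI; simp only: coords; use * in \<open>simp add: field_simps power2_eq_square\<close>)
    ultimately have "derivation br D"
      by (simp add: derivation_def)
    moreover have "\<forall>u. ricci_operator br g u = (- 3 / 2 * a\<^sup>2) *\<^sub>R u + D u"
      by (simp add: ricci_operator D_def)
    ultimately show "nilsoliton br g"
      unfolding nilsoliton_def by blast
  qed
qed

text \<open>Both metrics have the same Ricci tensor, so raising an index multiplies the Ricci
  operator by \<open>k\<close>; multiples of the identity and derivations are both closed under
  scaling.\<close>

lemma nilsoliton_rescale:
  assumes "g = (\<lambda>x y. k * h x y)" "inner_product h" "k > 0"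
  shows "nilsoliton br h \<longleftrightarrow> nilsoliton br g"
proof -
  have *: "ricci_operator br h u = k *\<^sub>R ricci_operator br g u" for u
  proof -
    have "ricci_tensor br h u w = h (k *\<^sub>R Ric u) w" for w
    proof -
      have "ricci_tensor br h u w = k * h (Ric u) w"
        using assms(1,3) ricci_tensor_eq[of u w] ricci_tensor_scale[of k br h] by simp
      then show ?thesis
        using bilinear_lmul[of h] assms(2) by (metis inner_product_def real_scaleR_def)
    qed
    then have "ricci_operator br h u = k *\<^sub>R Ric u"
      by (rule ricci_operator_eq[OF assms(2)])
    then show ?thesis
      by (simp add: ricci_operator_eq[OF ip ricci_tensor_eq])
  qed
  have derivation_scale: "derivation br (\<lambda>u. r *\<^sub>R D u)" if "derivation br D" for r D
    using that by (auto simp: derivation_def linear_iff br_simps algebra_simps)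
  show ?thesis
  proof
    assume "nilsoliton br h"
    then obtain e D where "derivation br D" "\<And>u. k *\<^sub>R ricci_operator br g u = e *\<^sub>R u + D u"
      by (auto simp: nilsoliton_def * )
    then have "inverse k *\<^sub>R k *\<^sub>R ricci_operator br g u = (inverse k * e) *\<^sub>R u + inverse k *\<^sub>R D u" for u
      by (simp add: scaleR_add_right del: scaleR_scaleR) simp
    then show "nilsoliton br g"
      using derivation_scale[OF \<open>derivation br D\<close>, of "inverse k"] \<open>k > 0\<close>
      by (auto simp: nilsoliton_def)
  next
    assume "nilsoliton br g"
    then obtain e D where "derivation br D" "\<And>u. ricci_operator br g u = e *\<^sub>R u + D u"
      by (auto simp: nilsoliton_def)
    then have "ricci_operator br h u = (k * e) *\<^sub>R u + k *\<^sub>R D u" for u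
      by (simp add: * scaleR_add_right)
    then show "nilsoliton br h"
      using derivation_scale[OF \<open>derivation br D\<close>, of k] by (auto simp: nilsoliton_def)
  qed
qed

end

section \<open>The two normal forms of the bracket\<close>

theorem corollary3:
  fixes br :: "'g::real_vector \<Rightarrow> 'g \<Rightarrow> 'g"
    and ip :: "'g \<Rightarrow> 'g \<Rightarrow> real"
    and v :: "nat \<Rightarrow> 'g"
    and \<alpha> \<beta> \<gamma> \<eta> :: real
  assumes "is_A41_plus_A1 br"
    and "inner_product ip"
    and "\<eta> > 0"
    and "basis5 v"
    and "orthonormal5 (\<lambda>x y. \<eta> * ip x y) v"
    and "\<alpha> > 0" and "\<beta> > 0"
    and "only_brackets br v (\<alpha> *\<^sub>R v 3 + \<gamma> *\<^sub>R v 5) (\<beta> *\<^sub>R v 5) \<or>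
         only_brackets br v (\<alpha> *\<^sub>R v 3 + \<gamma> *\<^sub>R v 4) (\<beta> *\<^sub>R v 5)"
  shows "nilsoliton br ip \<longleftrightarrow> \<gamma> = 0 \<and> \<alpha> = \<beta>"
proof -
  define g where "g = (\<lambda>x y. \<eta> * ip x y)"
  have main: "nilsoliton br ip \<longleftrightarrow> c = 0 \<and> d = 0 \<and> \<alpha> = \<beta>"
    if "only_brackets br v (\<alpha> *\<^sub>R v 3 + d *\<^sub>R v 4 + c *\<^sub>R v 5) (\<beta> *\<^sub>R v 5)" for c d
  proof -
    interpret nilpotent_frame5 g v br \<alpha> \<beta> c d
      using assms that by unfold_locales
        (simp_all add: g_def inner_product_scale is_A41_plus_A1_def lie_bracket_def)
    show ?thesis
      using nilsoliton_rescale[OF g_def] nilsoliton_iff assms by blast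
  qed
  \<comment> \<open>The first case is \<open>c = \<gamma>\<close>, \<open>d = 0\<close>; the second
    is \<open>c = 0\<close>, \<open>d = \<gamma>\<close>.\<close>
  from assms(8) show ?thesis
    using main[of 0 \<gamma>] main[of \<gamma> 0] by auto
qed

end
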